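(* For all real numbers $x_1\le x_2\le x_3$, $$\omega_3\Big(\frac{x_1+x_2+x_3}{3}\Big)\le \frac{\omega_3(x_1)+\omega_3(x_2)+\omega_3(x_3)}{3}+\frac13\,(x_3-x_1).$$
   Context: For real $x$, $\|x\|$ denotes the distance from $x$ to the nearest integer, and $\|x\|_{1/3}:=\min\{\|x\|,1/3\}$. Define $\omega_3(x):=\sum_{k=0}^\infty 3^{-k}\|3^kx\|_{1/3}$ for real $x$. *)

theory Defs
  imports "HOL-Analysis.Analysis"
begin

definition nint_dist :: "real \<Rightarrow> real" where
  "nint_dist x = \<bar>x - of_int (round x)\<bar>"

definition nint_dist_third :: "real \<Rightarrow> real" where
  "nint_dist_third x = min (nint_dist x) (1 / 3)"

definition omega3 :: "real \<Rightarrow> real" where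
  "omega3 x = (\<Sum>k. nint_dist_third (3 ^ k * x) / 3 ^ k)"

(* round breaks ties upwards; nint_dist does not depend on that choice. *)
lemma nint_dist_eq_infdist: "nint_dist x = infdist x \<int>"
proof (rule antisym)
  have ne: "(\<int> :: real set) \<noteq> {}"
    using Ints_0 by blast
  show "nint_dist x \<le> infdist x \<int>"
    unfolding infdist_notempty[OF ne]
  proof (rule cINF_greatest[OF ne])
    fix a :: real
    assume "a \<in> \<int>"
    then obtain m where "a = of_int m" by (auto elim: Ints_cases)
    then show "nint_dist x \<le> dist x a"
      using round_diff_minimal[of x m] by (simp add: nint_dist_def dist_real_def)
  qed
  show "infdist x \<int> \<le> nint_dist x"
    using infdist_le[of "of_int (round x)" \<int> x] by (simp add: nint_dist_def dist_real_def)
qed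

(* The series defining omega3 converges for every x, so suminf is its genuine sum. *)
lemma summable_omega3: "summable (\<lambda>k. nint_dist_third (3 ^ k * x) / 3 ^ k)"
proof (rule summable_comparison_test')
  show "summable (\<lambda>k. (1 / 3 :: real) ^ k)"
    by (rule summable_geometric) simp
  fix k :: nat
  have "0 \<le> nint_dist_third y" "nint_dist_third y \<le> 1" for y
    by (auto simp: nint_dist_third_def nint_dist_def)
  then show "norm (nint_dist_third (3 ^ k * x) / 3 ^ k) \<le> (1 / 3) ^ k"
    by (simp add: power_one_over divide_simps)
qed

end

theory Submission
  imports Defs
begin

text \<open>
  At triadic points, \<open>G n a = 3 ^ n * omega3 (a / 3 ^ n)\<close> satisfies
  \<open>G (n + 1) a = (\<Sum>k<3. G n ((a + k) div 3)) + [\<not> 3 dvd a]\<close>, because every summand of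
  \<open>omega3\<close> but the last is affine between neighbouring points of the coarser grid.
  The claim becomes
  \<open>G (n + 1) (a + b + c) \<le> G n a + G n b + G n c + (\<bar>a - b\<bar> + \<bar>b - c\<bar> + \<bar>c - a\<bar>) / 2\<close>
  for integers \<open>a, b, c\<close>. It follows by induction on \<open>n\<close>: the nine pieces \<open>(a + k) div 3\<close>,
  \<open>(b + k) div 3\<close>, \<open>(c + k) div 3\<close> can be grouped into three triples with sums
  \<open>(a + b + c + k) div 3\<close>, taking the increments from \<open>(a + k) div 3\<close> to
  \<open>(a + b + k) div 3\<close> to \<open>(a + b + c + k) div 3\<close>, and the pairwise distances lost by the grouping are
  controlled by the indicator terms. Continuity gives the result for all reals.
\<close>

section \<open>Shape of the truncated distance between triadic points\<close>

lemma nint_dist_third_cases: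
  fixes q :: int
  shows "of_int q \<le> x \<Longrightarrow> x \<le> of_int q + 1 / 3 \<Longrightarrow> nint_dist_third x = x - of_int q"
    and "of_int q + 1 / 3 \<le> x \<Longrightarrow> x \<le> of_int q + 2 / 3 \<Longrightarrow> nint_dist_third x = 1 / 3"
    and "of_int q + 2 / 3 \<le> x \<Longrightarrow> x \<le> of_int q + 1 \<Longrightarrow> nint_dist_third x = of_int q + 1 - x"
proof -
  have lo: "nint_dist x = x - of_int q" if "of_int q \<le> x" "x < of_int q + 1 / 2"
  proof -
    have "round x = q" using that by (intro round_unique) auto
    then show ?thesis using that by (simp add: nint_dist_def)
  qed
  have hi: "nint_dist x = of_int q + 1 - x" if "of_int q + 1 / 2 \<le> x" "x \<le> of_int q + 1"
  proof -
    have "round x = q + 1" using that by (intro round_unique) auto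
    then show ?thesis using that by (simp add: nint_dist_def)
  qed
  show "of_int q \<le> x \<Longrightarrow> x \<le> of_int q + 1 / 3 \<Longrightarrow> nint_dist_third x = x - of_int q"
    using lo by (simp add: nint_dist_third_def)
  show "of_int q + 1 / 3 \<le> x \<Longrightarrow> x \<le> of_int q + 2 / 3 \<Longrightarrow> nint_dist_third x = 1 / 3"
    using lo hi by (cases "x < of_int q + 1 / 2") (simp_all add: nint_dist_third_def)
  show "of_int q + 2 / 3 \<le> x \<Longrightarrow> x \<le> of_int q + 1 \<Longrightarrow> nint_dist_third x = of_int q + 1 - x"
    using hi by (simp add: nint_dist_third_def)
qed

lemma nint_dist_third_of_int [simp]: "nint_dist_third (of_int q) = 0"
  using nint_dist_third_cases(1)[of q "of_int q"] by simp

text \<open>Truncation at 1/3 cuts off the peaks at the half-integers, so every kink lies at a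
  multiple of 1/3.\<close>

lemma nint_dist_third_affine:
  fixes j :: int
  obtains s t where
    "\<And>x. of_int j / 3 \<le> x \<Longrightarrow> x \<le> (of_int j + 1) / 3 \<Longrightarrow> nint_dist_third x = s * x + t"
proof -
  define q where "q = j div 3"
  have "j = 3 * q \<or> j = 3 * q + 1 \<or> j = 3 * q + 2"
    unfolding q_def by presburger
  then show thesis
  proof (elim disjE)
    assume "j = 3 * q"
    then show thesis
      using nint_dist_third_cases(1)[of q] by (intro that[of 1 "- of_int q"]) auto
  next
    assume "j = 3 * q + 1"
    then show thesis
      using nint_dist_third_cases(2)[of q] by (intro that[of 0 "1 / 3"]) (auto simp: field_simps)
  next
    assume "j = 3 * q + 2"
    then show thesis
      using nint_dist_third_cases(3)[of q]
      by (intro that[of "- 1" "of_int q + 1"]) (auto simp: field_simps)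
  qed
qed

text \<open>Neighbouring points of the grid of mesh \<open>1 / 3 ^ Suc m\<close> lie in one affine
  piece, and the finer point divides the segment between them in the ratio
  \<open>r : 3 - r\<close>.\<close>

lemma nint_dist_third_interpolate:
  fixes b r :: int
  assumes "0 \<le> r" "r \<le> 3"
  shows "3 * nint_dist_third (of_int (3 * b + r) / 3 ^ Suc (Suc m)) =
    (3 - of_int r) * nint_dist_third (of_int b / 3 ^ Suc m) +
    of_int r * nint_dist_third (of_int (b + 1) / 3 ^ Suc m)"
proof -
  define j where "j = b div 3 ^ m"
  define l :: real where "l = of_int b / 3 ^ Suc m"
  define h :: real where "h = 1 / 3 ^ Suc m"
  obtain s t where affine:
    "\<And>x. of_int j / 3 \<le> x \<Longrightarrow> x \<le> (of_int j + 1) / 3 \<Longrightarrow> nint_dist_third x = s * x + t"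
    using nint_dist_third_affine[of j] by metis
  have "0 \<le> b mod 3 ^ m" "b mod 3 ^ m < 3 ^ m" by simp_all
  \<comment> \<open>The inequality \<open>b < (j + 1) * 3 ^ m\<close> is strict between integers, so
    \<open>b + 1\<close> still belongs to the closed cell.\<close>
  then have "j * 3 ^ m \<le> b" "b + 1 \<le> (j + 1) * 3 ^ m"
    using div_mult_mod_eq[of b "3 ^ m"] unfolding j_def distrib_right by linarith+
  then have "of_int (j * 3 ^ m) \<le> (of_int b :: real)" "of_int (b + 1) \<le> (of_int ((j + 1) * 3 ^ m) :: real)"
    by (simp_all only: of_int_le_iff)
  then have ends: "of_int j / 3 \<le> l" "l + h \<le> (of_int j + 1) / 3"
    by (simp_all add: l_def h_def field_simps)
  have "0 \<le> h" by (simp add: h_def)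
  have "0 \<le> of_int r * h" "of_int r * h \<le> 3 * h"
    using assms \<open>0 \<le> h\<close> by (auto intro: mult_right_mono)
  then have "nint_dist_third (l + of_int r * h / 3) = s * (l + of_int r * h / 3) + t"
    using ends by (intro affine) auto
  moreover have "nint_dist_third l = s * l + t" "nint_dist_third (l + h) = s * (l + h) + t"
    using ends \<open>0 \<le> h\<close> by (auto intro!: affine)
  moreover have "of_int (3 * b + r) / 3 ^ Suc (Suc m) = l + of_int r * h / 3"
    "of_int b / 3 ^ Suc m = l" "of_int (b + 1) / 3 ^ Suc m = l + h"
    by (simp_all add: l_def h_def field_simps)
  ultimately show ?thesis
    by (simp only:) (simp add: algebra_simps)
qed

section \<open>Values of \<open>omega3\<close> at triadic points\<close>

text \<open>The series is read backwards, with \<open>k = n - Suc m\<close>: the summands then do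
  not depend on \<open>n\<close>, and refining the grid only shifts their index.\<close>

definition triadic_omega :: "nat \<Rightarrow> int \<Rightarrow> real" where
  "triadic_omega n a = (\<Sum>m<n. 3 ^ Suc m * nint_dist_third (of_int a / 3 ^ Suc m))"

text \<open>For \<open>k >= n\<close> the argument \<open>3 ^ k * (a / 3 ^ n)\<close> is an integer,
  so the series breaks off.\<close>

lemma omega3_triadic: "3 ^ n * omega3 (of_int a / 3 ^ n) = triadic_omega n a"
proof -
  let ?f = "\<lambda>k. nint_dist_third (3 ^ k * (of_int a / 3 ^ n)) / 3 ^ k"
  have "?f k = 0" if "k \<notin> {..<n}" for k
  proof -
    have "(3::real) ^ k = 3 ^ (k - n) * 3 ^ n"
      using that by (simp flip: power_add)
    then have "3 ^ k * (of_int a / 3 ^ n) = (of_int (3 ^ (k - n) * a) :: real)"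
      by simp
    then show ?thesis by (simp only: nint_dist_third_of_int div_0)
  qed
  then have "omega3 (of_int a / 3 ^ n) = (\<Sum>k<n. ?f k)"
    unfolding omega3_def by (intro suminf_finite) auto
  also have "\<dots> = (\<Sum>m<n. ?f (n - Suc m))"
    by (rule sum.nat_diff_reindex[symmetric])
  finally have "3 ^ n * omega3 (of_int a / 3 ^ n) = (\<Sum>m<n. 3 ^ n * ?f (n - Suc m))"
    by (simp only: sum_distrib_left)
  also have "\<dots> = triadic_omega n a"
    unfolding triadic_omega_def
  proof (rule sum.cong)
    fix m assume "m \<in> {..<n}"
    then have "(3::real) ^ n = 3 ^ (n - Suc m) * 3 ^ Suc m"
      by (simp flip: power_add power_Suc)
    then show "3 ^ n * ?f (n - Suc m) = 3 ^ Suc m * nint_dist_third (of_int a / 3 ^ Suc m)"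
      by simp
  qed simp
  finally show ?thesis .
qed

text \<open>The summands of positive index interpolate those of the coarser grid; the summand of
  index 0 is three times 0 or 1/3, which is the indicator.\<close>

lemma triadic_omega_Suc_interpolate:
  fixes b r :: int
  assumes "0 \<le> r" "r < 3"
  shows "triadic_omega (Suc n) (3 * b + r) =
    (3 - of_int r) * triadic_omega n b + of_int r * triadic_omega n (b + 1) + of_bool (r \<noteq> 0)"
proof -
  have "r = 0 \<or> r = 1 \<or> r = 2" using assms by auto
  then have "3 * nint_dist_third (of_int (3 * b + r) / 3) = of_bool (r \<noteq> 0)"
    using nint_dist_third_cases(2)[of b "of_int (3 * b + r) / 3"]
      nint_dist_third_of_int[of b] by auto
  moreover have "(\<Sum>m<n. 3 ^ Suc (Suc m) * nint_dist_third (of_int (3 * b + r) / 3 ^ Suc (Suc m))) =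
    (\<Sum>m<n. 3 ^ Suc m * (3 * nint_dist_third (of_int (3 * b + r) / 3 ^ Suc (Suc m))))"
    by (simp add: algebra_simps)
  moreover have "\<dots> = (3 - of_int r) * triadic_omega n b + of_int r * triadic_omega n (b + 1)"
    using assms unfolding triadic_omega_def sum_distrib_left sum.distrib[symmetric]
    by (intro sum.cong refl, subst nint_dist_third_interpolate) (auto simp: algebra_simps)
  ultimately show ?thesis
    unfolding triadic_omega_def[of "Suc n"] sum.lessThan_Suc_shift by simp
qed

text \<open>For \<open>a = 3 * b + r\<close> the three quotients are \<open>3 - r\<close> copies of
  \<open>b\<close> and \<open>r\<close> copies of \<open>b + 1\<close>, matching the interpolation
  weights.\<close>

lemma triadic_omega_Suc:
  "triadic_omega (Suc n) a =
    triadic_omega n (a div 3) + triadic_omega n ((a + 1) div 3) + triadic_omega n ((a + 2) div 3)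
    + of_bool (\<not> 3 dvd a)"
proof -
  define b where "b = a div 3"
  have "a = 3 * b + 0 \<or> a = 3 * b + 1 \<or> a = 3 * b + 2"
    unfolding b_def by presburger
  moreover have "\<not> 3 dvd 3 * b + 1" "\<not> 3 dvd 3 * b + 2"
    "(3 * b + 2) div 3 = b" "(3 * b + 1) div 3 = b" "(3 * b + 3) div 3 = b + 1" "(3 * b + 4) div 3 = b + 1"
    by presburger+
  ultimately show ?thesis
    using triadic_omega_Suc_interpolate[of 0 n b] triadic_omega_Suc_interpolate[of 1 n b]
      triadic_omega_Suc_interpolate[of 2 n b]
    by (elim disjE) (simp_all add: add.assoc)
qed

section \<open>Loss of pairwise distances under regrouping\<close>

text \<open>Only \<open>d = 0\<close> causes a loss: otherwise no term \<open>d + e\<^sub>i\<close> changes sign.\<close>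

lemma sum_abs_shift_le:
  fixes d e0 e1 e2 :: int
  assumes "\<bar>e0\<bar> \<le> 1" "\<bar>e1\<bar> \<le> 1" "\<bar>e2\<bar> \<le> 1"
  shows "\<bar>d + e0\<bar> + \<bar>d + e1\<bar> + \<bar>d + e2\<bar>
    \<le> \<bar>3 * d + (e0 + e1 + e2)\<bar> + (\<bar>e0\<bar> + \<bar>e1\<bar> + \<bar>e2\<bar> - \<bar>e0 + e1 + e2\<bar>)"
proof -
  have triangle: "\<bar>e0 + e1 + e2\<bar> \<le> \<bar>e0\<bar> + \<bar>e1\<bar> + \<bar>e2\<bar>"
    by linarith
  consider "d = 0" | "d \<ge> 1" | "d \<le> - 1" by linarith
  then show ?thesis
  proof cases
    case 1
    then show ?thesis by simp
  next
    case 2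
    then have "0 \<le> d + e0" "0 \<le> d + e1" "0 \<le> d + e2" using assms by linarith+
    then show ?thesis using triangle by (smt (verit))
  next
    case 3
    then have "d + e0 \<le> 0" "d + e1 \<le> 0" "d + e2 \<le> 0" using assms by linarith+
    then show ?thesis using triangle by (smt (verit))
  qed
qed

text \<open>Half of this is the maximum minus the minimum. The symmetric form suits the induction:
  its triples need not stay ordered, and each pair can be estimated separately.\<close>

definition spread :: "int \<Rightarrow> int \<Rightarrow> int \<Rightarrow> int" where
  "spread a b c = \<bar>a - b\<bar> + \<bar>b - c\<bar> + \<bar>c - a\<bar>"

text \<open>The triples are the carries when \<open>a\<close>, \<open>b\<close>, \<open>c\<close>
  are added to \<open>k\<close> in turn, each remainder mod 3 being passed on. Splitting off the
  quotients of \<open>a\<close>, \<open>b\<close>, \<open>c\<close> leaves a loss that depends on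
  their residues only.\<close>

lemma spread_div_le:
  fixes a b c :: int
  defines "u \<equiv> \<lambda>k. (a + k) div 3"
    and "v \<equiv> \<lambda>k. (b + (a + k) mod 3) div 3"
    and "w \<equiv> \<lambda>k. (c + (a + b + k) mod 3) div 3"
  shows "spread (u 0) (v 0) (w 0) + spread (u 1) (v 1) (w 1) + spread (u 2) (v 2) (w 2)
      + 2 * of_bool (\<not> 3 dvd a + b + c)
    \<le> spread a b c + 2 * (of_bool (\<not> 3 dvd a) + of_bool (\<not> 3 dvd b) + of_bool (\<not> 3 dvd c))"
proof -
  define p q t where "p = a div 3" and "q = b div 3" and "t = c div 3"
  define \<alpha> \<beta> \<gamma> where "\<alpha> = a mod 3" and "\<beta> = b mod 3" and "\<gamma> = c mod 3"
  have abc: "a = 3 * p + \<alpha>" "b = 3 * q + \<beta>" "c = 3 * t + \<gamma>"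
    by (simp_all add: p_def q_def t_def \<alpha>_def \<beta>_def \<gamma>_def)
  define e where "e k = (\<alpha> + k) div 3" for k
  define f where "f k = (\<beta> + (\<alpha> + k) mod 3) div 3" for k
  define g where "g k = (\<gamma> + (\<alpha> + \<beta> + k) mod 3) div 3" for k
  have shift: "(3 * m + x) div 3 = m + x div 3" "(3 * m + x) mod 3 = x mod 3" for m x :: int
    by simp_all
  have regroup: "a + x = 3 * p + (\<alpha> + x)" "b + x = 3 * q + (\<beta> + x)" "c + x = 3 * t + (\<gamma> + x)"
    "a + b + x = 3 * (p + q) + (\<alpha> + \<beta> + x)" for x
    using abc by simp_all
  have uvw: "u k = p + e k" "v k = q + f k" "w k = t + g k" for k
    unfolding u_def v_def w_def e_def f_def g_def
    by (simp_all only: regroup(3,4) shift) (simp_all only: regroup(1,2) shift)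
  have dvd: "3 dvd a \<longleftrightarrow> 3 dvd \<alpha>" "3 dvd b \<longleftrightarrow> 3 dvd \<beta>" "3 dvd c \<longleftrightarrow> 3 dvd \<gamma>"
    "3 dvd a + b + c \<longleftrightarrow> 3 dvd \<alpha> + \<beta> + \<gamma>"
    unfolding abc by presburger+
  have residues: "\<alpha> \<in> {0, 1, 2}" "\<beta> \<in> {0, 1, 2}" "\<gamma> \<in> {0, 1, 2}"
    unfolding \<alpha>_def \<beta>_def \<gamma>_def by auto
  \<comment> \<open>The correction term of \<open>sum_abs_shift_le\<close> for the shifts
    \<open>x k - y k\<close>, whose sum will be \<open>r - s\<close>.\<close>
  define loss where
    "loss x y r s = \<bar>x 0 - y 0\<bar> + \<bar>x 1 - y 1\<bar> + \<bar>x 2 - y 2\<bar> - \<bar>r - s\<bar>"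
    for x y :: "int \<Rightarrow> int" and r s :: int
  \<comment> \<open>No quotient occurs here, so evaluating the 27 residue triples suffices.\<close>
  have "(e 0 + e 1 + e 2 = \<alpha> \<and> f 0 + f 1 + f 2 = \<beta> \<and> g 0 + g 1 + g 2 = \<gamma>)
    \<and> (\<forall>k \<in> {0, 1, 2}. \<bar>e k - f k\<bar> \<le> 1 \<and> \<bar>f k - g k\<bar> \<le> 1 \<and> \<bar>g k - e k\<bar> \<le> 1)
    \<and> loss e f \<alpha> \<beta> + loss f g \<beta> \<gamma> + loss g e \<gamma> \<alpha> + 2 * of_bool (\<not> 3 dvd \<alpha> + \<beta> + \<gamma>)
      \<le> 2 * (of_bool (\<not> 3 dvd \<alpha>) + of_bool (\<not> 3 dvd \<beta>) + of_bool (\<not> 3 dvd \<gamma>))"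
    using residues unfolding loss_def e_def f_def g_def by (elim insertE emptyE; simp)
  then have total: "e 0 + e 1 + e 2 = \<alpha>" "f 0 + f 1 + f 2 = \<beta>" "g 0 + g 1 + g 2 = \<gamma>"
    and small: "k \<in> {0, 1, 2} \<Longrightarrow> \<bar>e k - f k\<bar> \<le> 1" "k \<in> {0, 1, 2} \<Longrightarrow> \<bar>f k - g k\<bar> \<le> 1"
      "k \<in> {0, 1, 2} \<Longrightarrow> \<bar>g k - e k\<bar> \<le> 1"
    and losses: "loss e f \<alpha> \<beta> + loss f g \<beta> \<gamma> + loss g e \<gamma> \<alpha> + 2 * of_bool (\<not> 3 dvd \<alpha> + \<beta> + \<gamma>)
      \<le> 2 * (of_bool (\<not> 3 dvd \<alpha>) + of_bool (\<not> 3 dvd \<beta>) + of_bool (\<not> 3 dvd \<gamma>))" for k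
    by blast+
  have pair: "\<bar>(m + x 0) - (n + y 0)\<bar> + \<bar>(m + x 1) - (n + y 1)\<bar> + \<bar>(m + x 2) - (n + y 2)\<bar>
      \<le> \<bar>(3 * m + r) - (3 * n + s)\<bar> + loss x y r s"
    if "\<And>k. k \<in> {0, 1, 2} \<Longrightarrow> \<bar>x k - y k\<bar> \<le> 1" "x 0 + x 1 + x 2 = r" "y 0 + y 1 + y 2 = s"
    for m n r s :: int and x y
  proof -
    have bounds: "\<bar>x 0 - y 0\<bar> \<le> 1" "\<bar>x 1 - y 1\<bar> \<le> 1" "\<bar>x 2 - y 2\<bar> \<le> 1"
      using that(1) by simp_all
    have "(m + x k) - (n + y k) = (m - n) + (x k - y k)" for k by simp
    moreover have "(3 * m + r) - (3 * n + s) = 3 * (m - n) + ((x 0 - y 0) + (x 1 - y 1) + (x 2 - y 2))"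
      "r - s = (x 0 - y 0) + (x 1 - y 1) + (x 2 - y 2)"
      using that(2,3) by simp_all
    ultimately show ?thesis
      using sum_abs_shift_le[OF bounds, of "m - n"] by (simp only: loss_def)
  qed
  define AB BC CA where "AB = \<bar>u 0 - v 0\<bar> + \<bar>u 1 - v 1\<bar> + \<bar>u 2 - v 2\<bar>"
    and "BC = \<bar>v 0 - w 0\<bar> + \<bar>v 1 - w 1\<bar> + \<bar>v 2 - w 2\<bar>"
    and "CA = \<bar>w 0 - u 0\<bar> + \<bar>w 1 - u 1\<bar> + \<bar>w 2 - u 2\<bar>"
  have "AB \<le> \<bar>a - b\<bar> + loss e f \<alpha> \<beta>"
    unfolding AB_def uvw abc by (intro pair total small)
  moreover have "BC \<le> \<bar>b - c\<bar> + loss f g \<beta> \<gamma>"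
    unfolding BC_def uvw abc by (intro pair total small)
  moreover have "CA \<le> \<bar>c - a\<bar> + loss g e \<gamma> \<alpha>"
    unfolding CA_def uvw abc by (intro pair total small)
  ultimately have "AB + BC + CA + 2 * of_bool (\<not> 3 dvd \<alpha> + \<beta> + \<gamma>)
      \<le> spread a b c + 2 * (of_bool (\<not> 3 dvd \<alpha>) + of_bool (\<not> 3 dvd \<beta>) + of_bool (\<not> 3 dvd \<gamma>))"
    using losses unfolding spread_def by linarith
  then show ?thesis
    unfolding dvd AB_def BC_def CA_def by (simp add: spread_def)
qed

section \<open>Induction on the triadic level\<close>

lemma triadic_omega_Suc_add_le:
  "triadic_omega (Suc n) (a + b + c) \<le>
    triadic_omega n a + triadic_omega n b + triadic_omega n c + of_int (spread a b c) / 2"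
proof (induction n arbitrary: a b c)
  case 0
  \<comment> \<open>At level 0 the left side is just the indicator; when it is 1, the three integers
    are not all equal.\<close>
  have "\<not> 3 dvd a + b + c \<Longrightarrow> 2 \<le> spread a b c"
    unfolding spread_def by presburger
  moreover have "0 \<le> spread a b c" by (simp add: spread_def)
  ultimately show ?case
    by (cases "3 dvd a + b + c") (auto simp: triadic_omega_Suc, simp_all add: triadic_omega_def)
next
  case (Suc n)
  let ?G = "triadic_omega n"
  define u where "u k = (a + k) div 3" for k
  define v where "v k = (b + (a + k) mod 3) div 3" for k
  define w where "w k = (c + (a + b + k) mod 3) div 3" for k
  have carry: "(x + y mod 3) div 3 = (x + y) div 3 - y div 3" for x y :: int
    by presburger
  have sums: "u k + v k + w k = (a + b + c + k) div 3" for k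
  proof -
    have regroup: "b + (a + k) = a + b + k" "c + (a + b + k) = a + b + c + k" by simp_all
    show ?thesis unfolding u_def v_def w_def carry regroup by simp
  qed
  \<comment> \<open>The remainders of \<open>y\<close>, \<open>y + 1\<close>, \<open>y + 2\<close>
    are 0, 1, 2 in some order, so passing on a remainder only permutes the pieces of
    \<open>b\<close> and of \<open>c\<close>.\<close>
  have perm: "g ((x + y mod 3) div 3) + g ((x + (y + 1) mod 3) div 3) + g ((x + (y + 2) mod 3) div 3)
      = g (x div 3) + g ((x + 1) div 3) + g ((x + 2) div 3)" for g :: "int \<Rightarrow> real" and x y
  proof -
    have "y mod 3 = 0 \<and> (y + 1) mod 3 = 1 \<and> (y + 2) mod 3 = 2
        \<or> y mod 3 = 1 \<and> (y + 1) mod 3 = 2 \<and> (y + 2) mod 3 = 0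
        \<or> y mod 3 = 2 \<and> (y + 1) mod 3 = 0 \<and> (y + 2) mod 3 = 1"
      by presburger
    then show ?thesis by (elim disjE) simp_all
  qed
  have split: "triadic_omega (Suc n) a = ?G (u 0) + ?G (u 1) + ?G (u 2) + of_bool (\<not> 3 dvd a)"
    "triadic_omega (Suc n) b = ?G (v 0) + ?G (v 1) + ?G (v 2) + of_bool (\<not> 3 dvd b)"
    "triadic_omega (Suc n) c = ?G (w 0) + ?G (w 1) + ?G (w 2) + of_bool (\<not> 3 dvd c)"
    unfolding triadic_omega_Suc[of n] u_def v_def w_def add_0_right perm by (rule refl)+
  have "triadic_omega (Suc (Suc n)) (a + b + c) =
      triadic_omega (Suc n) (u 0 + v 0 + w 0) + triadic_omega (Suc n) (u 1 + v 1 + w 1)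
      + triadic_omega (Suc n) (u 2 + v 2 + w 2) + of_bool (\<not> 3 dvd a + b + c)"
    unfolding sums by (subst triadic_omega_Suc) simp
  also have "\<dots> \<le> (?G (u 0) + ?G (u 1) + ?G (u 2)) + (?G (v 0) + ?G (v 1) + ?G (v 2))
      + (?G (w 0) + ?G (w 1) + ?G (w 2))
      + of_int (spread (u 0) (v 0) (w 0) + spread (u 1) (v 1) (w 1) + spread (u 2) (v 2) (w 2)
        + 2 * of_bool (\<not> 3 dvd a + b + c)) / 2"
    using Suc.IH[of "u 0" "v 0" "w 0"] Suc.IH[of "u 1" "v 1" "w 1"] Suc.IH[of "u 2" "v 2" "w 2"]
    by (simp add: add_divide_distrib)
  \<comment> \<open>The indicators of \<open>a\<close>, \<open>b\<close>, \<open>c\<close> pay for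
    both the lost distances and the indicator of the sum.\<close>
  also have "\<dots> \<le> (?G (u 0) + ?G (u 1) + ?G (u 2)) + (?G (v 0) + ?G (v 1) + ?G (v 2))
      + (?G (w 0) + ?G (w 1) + ?G (w 2))
      + of_int (spread a b c + 2 * (of_bool (\<not> 3 dvd a) + of_bool (\<not> 3 dvd b) + of_bool (\<not> 3 dvd c))) / 2"
    unfolding u_def v_def w_def
    by (intro add_left_mono divide_right_mono of_int_le_iff[THEN iffD2] spread_div_le) simp
  also have "\<dots> = triadic_omega (Suc n) a + triadic_omega (Suc n) b + triadic_omega (Suc n) c
      + of_int (spread a b c) / 2"
    unfolding split by (simp add: add_divide_distrib)
  finally show ?case .
qed

text \<open>The mean has denominator \<open>3 ^ Suc n\<close>, which accounts for the extra level on
  the left of the integer inequality; scaling by this power gives the claim.\<close>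

lemma omega3_triadic_mean_le:
  fixes a b c :: int
  assumes "a \<le> b" "b \<le> c"
  shows "omega3 ((of_int a / 3 ^ n + of_int b / 3 ^ n + of_int c / 3 ^ n) / 3)
    \<le> (omega3 (of_int a / 3 ^ n) + omega3 (of_int b / 3 ^ n) + omega3 (of_int c / 3 ^ n)) / 3
      + 1 / 3 * (of_int c / 3 ^ n - of_int a / 3 ^ n)"
proof -
  have "(of_int a / 3 ^ n + of_int b / 3 ^ n + of_int c / 3 ^ n) / 3
      = (of_int (a + b + c) / 3 ^ Suc n :: real)"
    by (simp add: field_simps)
  moreover have "of_int (spread a b c) / 2 = (of_int c - of_int a :: real)"
    using assms by (simp add: spread_def)
  ultimately show ?thesis
    using triadic_omega_Suc_add_le[of n a b c]
    unfolding omega3_triadic[symmetric] by (simp add: field_simps)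
qed

section \<open>Passage from triadic points to all reals\<close>

text \<open>The series of continuous terms converges uniformly, being dominated by the geometric
  series of ratio 1/3.\<close>

lemma continuous_on_omega3: "continuous_on UNIV omega3"
proof -
  have "continuous_on UNIV nint_dist_third"
    unfolding nint_dist_third_def nint_dist_eq_infdist by (intro continuous_intros)
  then have cont: "continuous_on UNIV (\<lambda>x. nint_dist_third (3 ^ k * x) / 3 ^ k)" for k :: nat
    by (intro continuous_intros continuous_on_compose2[OF \<open>continuous_on UNIV nint_dist_third\<close>])
      simp_all
  have "uniform_limit UNIV (\<lambda>n x. \<Sum>k<n. nint_dist_third (3 ^ k * x) / 3 ^ k) omega3 sequentially"
    unfolding omega3_def
  proof (rule Weierstrass_m_test)
    show "summable (\<lambda>k. (1 / 3 :: real) ^ k)" by (rule summable_geometric) simp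
    have "\<bar>nint_dist_third x\<bar> \<le> 1" for x
      by (auto simp: nint_dist_third_def nint_dist_def)
    then show "norm (nint_dist_third (3 ^ k * x) / 3 ^ k) \<le> (1 / 3) ^ k" for k :: nat and x
      by (simp add: power_one_over divide_simps)
  qed
  then show ?thesis
    by (rule uniform_limit_theorem[rotated]) (auto intro!: always_eventually continuous_on_sum cont)
qed

lemma tendsto_floor_triadic: "(\<lambda>n. of_int \<lfloor>3 ^ n * x\<rfloor> / 3 ^ n) \<longlonglongrightarrow> (x :: real)"
proof (rule tendsto_sandwich)
  have "(\<lambda>n. (1 / 3 :: real) ^ n) \<longlonglongrightarrow> 0" by (rule LIMSEQ_realpow_zero) auto
  then show "(\<lambda>n. x - (1 / 3) ^ n) \<longlonglongrightarrow> x"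
    using tendsto_diff[OF tendsto_const[of x]] by fastforce
  have "3 ^ n * x - 1 \<le> of_int \<lfloor>3 ^ n * x\<rfloor>" for n by linarith
  then have "(3 ^ n * x - 1) / 3 ^ n \<le> of_int \<lfloor>3 ^ n * x\<rfloor> / 3 ^ n" for n
    by (intro divide_right_mono) auto
  then show "\<forall>\<^sub>F n in sequentially. x - (1 / 3) ^ n \<le> of_int \<lfloor>3 ^ n * x\<rfloor> / 3 ^ n"
    by (simp add: diff_divide_distrib power_one_over)
  show "\<forall>\<^sub>F n in sequentially. of_int \<lfloor>3 ^ n * x\<rfloor> / 3 ^ n \<le> x"
    by (simp add: divide_le_eq mult.commute)
qed simp

theorem theorem3:
  fixes x1 x2 x3 :: real
  assumes "x1 \<le> x2" and "x2 \<le> x3"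
  shows "omega3 ((x1 + x2 + x3) / 3)
    \<le> (omega3 x1 + omega3 x2 + omega3 x3) / 3 + 1 / 3 * (x3 - x1)"
proof -
  have lim: "(\<lambda>n. omega3 (f n)) \<longlonglongrightarrow> omega3 x" if "f \<longlonglongrightarrow> x" for f x
    using continuous_on_tendsto_compose[OF continuous_on_omega3 that] by simp
  \<comment> \<open>Rounding down is monotone, so the approximants inherit the order of
    \<open>x1\<close>, \<open>x2\<close>, \<open>x3\<close>.\<close>
  define y :: "real \<Rightarrow> nat \<Rightarrow> real" where "y x n = of_int \<lfloor>3 ^ n * x\<rfloor> / 3 ^ n" for x n
  have y: "y x \<longlonglongrightarrow> x" for x
    unfolding y_def by (rule tendsto_floor_triadic)
  show ?thesis
  proof (rule tendsto_le[OF sequentially_bot])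
    show "(\<lambda>n. omega3 ((y x1 n + y x2 n + y x3 n) / 3)) \<longlonglongrightarrow> omega3 ((x1 + x2 + x3) / 3)"
      by (intro lim tendsto_intros y) simp
    show "(\<lambda>n. (omega3 (y x1 n) + omega3 (y x2 n) + omega3 (y x3 n)) / 3 + 1 / 3 * (y x3 n - y x1 n))
        \<longlonglongrightarrow> (omega3 x1 + omega3 x2 + omega3 x3) / 3 + 1 / 3 * (x3 - x1)"
      by (intro lim tendsto_intros y) simp
    show "\<forall>\<^sub>F n in sequentially. omega3 ((y x1 n + y x2 n + y x3 n) / 3)
        \<le> (omega3 (y x1 n) + omega3 (y x2 n) + omega3 (y x3 n)) / 3 + 1 / 3 * (y x3 n - y x1 n)"
      unfolding y_def using assms
      by (intro always_eventually allI omega3_triadic_mean_le floor_mono mult_left_mono) auto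
  qed
qed

end
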